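(* Let $\mu_1>\lambda>\mu_2>0$ and let $d_1\ge 2$ be an integer. Then the system of differential equations (FL) given in the context always has the following fixed point: $$\overline{q}_{i0}^* = 0,\qquad \overline{q}_{i1}^* = \left(\frac{\lambda-\mu_2}{\mu_1-\mu_2}\right)^{\frac{d_1^i-1}{d_1-1}},\qquad i=0,1,2,\dots.$$ Furthermore, let $d_1^*=d_1^*(\lambda,\mu_1,\mu_2)$ be the smallest integer $d\ge 2$ satisfying both $$d\,\lambda \left( \frac{1}{\mu_2} - \frac{1}{\mu_1} \right) > 1 \quad\text{and}\quad \left(1- \frac{1}{d}\right) \frac{\mu_1}{\lambda} > \left( d\,\lambda \left( \frac{1}{\mu_2} - \frac{1}{\mu_1}\right) \right)^{\frac{1}{d-1}}.$$ When $d_1\ge d_1^*$, precisely two more fixed points of (FL) exist, and these fixed points are such that $q_{00}+q_{01}+q_{10}=1$ and $q_{00}>0$.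
   Context: **State space.** States are families $(q_{ij})_{i\ge 0,\ j\in\{0,1\}}$ with $q_{ij}\ge 0$ and $\sum_{i,j}q_{ij}=1$. Equivalently, a state is described by the tail sums $\overline{q}_{ij}=\sum_{k\ge i}q_{kj}$, so that $q_{ij}=\overline q_{ij}-\overline q_{i+1,j}$ and $\overline q_{00}+\overline q_{01}=1$. ($q_{ij}$ represents the fraction of servers with $i$ type I jobs and $j$ type II jobs.) **System (FL).** With $x^+=\max(x,0)$, put $\tilde\lambda=(\lambda-\mu_1q_{10}-\mu_2q_{01})^+$. The equations are $$\begin{aligned} \tfrac{d}{dt}\overline q_{00}&=\mu_2(\overline q_{01}-\overline q_{11})-\lambda(1-q_{00})^{d_1}+\tilde\lambda\,\mathbf 1\{q_{00}=0\},\\ \tfrac{d}{dt}\overline q_{01}&=\mu_2(\overline q_{11}-\overline q_{01})+\mathbf 1\{q_{00}>0\}\,\lambda(1-q_{00})^{d_1}+\mathbf 1\{q_{00}=0\}\,[\lambda-\tilde\lambda],\\ \tfrac{d}{dt}\overline q_{10}&=\mu_1(\overline q_{20}-\overline q_{10})+\mathbf 1\{q_{00}>0\}\,\lambda\left(1-(1-q_{00})^{d_1}\right),\\ \tfrac{d}{dt}\overline q_{11}&=\mu_1(\overline q_{21}-\overline q_{11})+\tilde\lambda\,\mathbf 1\{q_{00}=0\}\left[(\overline q_{10}+\overline q_{01})^{d_1}-(\overline q_{10}+\overline q_{11})^{d_1}\right], \end{aligned}$$ and for $i\ge 2$ $$\begin{aligned} \tfrac{d}{dt}\overline q_{i0}&=\mu_1(\overline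 q_{i+1,0}-\overline q_{i0})+\tilde\lambda\,\mathbf 1\{q_{00}=0\}\left[(\overline q_{i-1,0}+\overline q_{i-1,1})^{d_1}-(\overline q_{i0}+\overline q_{i-1,1})^{d_1}\right],\\ \tfrac{d}{dt}\overline q_{i1}&=\mu_1(\overline q_{i+1,1}-\overline q_{i1})+\tilde\lambda\,\mathbf 1\{q_{00}=0\}\left[(\overline q_{i0}+\overline q_{i-1,1})^{d_1}-(\overline q_{i0}+\overline q_{i1})^{d_1}\right]. \end{aligned}$$ **Fixed point.** A fixed point of (FL) is a state at which all right-hand sides of (FL) vanish. *)

theory Defs
  imports "HOL-Analysis.Analysis"
begin

text \<open>The second index ranges over the two-element type \<open>2\<close>, whose elements are \<open>0\<close> and
  \<open>1\<close>, so that distinct functions are distinct states.\<close>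

definition is_state :: "(nat \<Rightarrow> 2 \<Rightarrow> real) \<Rightarrow> bool" where
  "is_state q \<longleftrightarrow> (\<forall>i j. q i j \<ge> 0) \<and> ((\<lambda>(i, j). q i j) has_sum 1) UNIV"

definition tail :: "(nat \<Rightarrow> 2 \<Rightarrow> real) \<Rightarrow> nat \<Rightarrow> 2 \<Rightarrow> real" where
  "tail q i j = (\<Sum>\<^sub>\<infinity>k\<in>{i..}. q k j)"

definition lam_tilde :: "real \<Rightarrow> real \<Rightarrow> real \<Rightarrow> (nat \<Rightarrow> 2 \<Rightarrow> real) \<Rightarrow> real" where
  "lam_tilde lam \<mu>1 \<mu>2 q = max (lam - \<mu>1 * q 1 0 - \<mu>2 * q 0 1) 0"

text \<open>\<open>FL_rhs lam \<mu>1 \<mu>2 d q i j\<close> is the value of the time derivative of \<open>tail q i j\<close>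
  prescribed by (FL) at the state \<open>q\<close>.\<close>

definition FL_rhs ::
  "real \<Rightarrow> real \<Rightarrow> real \<Rightarrow> nat \<Rightarrow> (nat \<Rightarrow> 2 \<Rightarrow> real) \<Rightarrow> nat \<Rightarrow> 2 \<Rightarrow> real" where
  "FL_rhs lam \<mu>1 \<mu>2 d q i j =
    (let Q = tail q;
         lt = lam_tilde lam \<mu>1 \<mu>2 q;
         zero = of_bool (q 0 0 = 0);
         pos = of_bool (q 0 0 > 0)
     in
      if j = 0 then
       (if i = 0 then
          \<mu>2 * (Q 0 1 - Q 1 1) - lam * (1 - q 0 0) ^ d + lt * zero
        else if i = 1 then
          \<mu>1 * (Q 2 0 - Q 1 0) + pos * lam * (1 - (1 - q 0 0) ^ d)
        else
          \<mu>1 * (Q (i + 1) 0 - Q i 0)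
            + lt * zero * ((Q (i - 1) 0 + Q (i - 1) 1) ^ d - (Q i 0 + Q (i - 1) 1) ^ d))
      else
       (if i = 0 then
          \<mu>2 * (Q 1 1 - Q 0 1) + pos * lam * (1 - q 0 0) ^ d + zero * (lam - lt)
        else if i = 1 then
          \<mu>1 * (Q 2 1 - Q 1 1) + lt * zero * ((Q 1 0 + Q 0 1) ^ d - (Q 1 0 + Q 1 1) ^ d)
        else
          \<mu>1 * (Q (i + 1) 1 - Q i 1)
            + lt * zero * ((Q i 0 + Q (i - 1) 1) ^ d - (Q i 0 + Q i 1) ^ d)))"

definition FL_fixed_point ::
  "real \<Rightarrow> real \<Rightarrow> real \<Rightarrow> nat \<Rightarrow> (nat \<Rightarrow> 2 \<Rightarrow> real) \<Rightarrow> bool" where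
  "FL_fixed_point lam \<mu>1 \<mu>2 d q \<longleftrightarrow> is_state q \<and> (\<forall>i j. FL_rhs lam \<mu>1 \<mu>2 d q i j = 0)"

definition d_star_cond :: "real \<Rightarrow> real \<Rightarrow> real \<Rightarrow> nat \<Rightarrow> bool" where
  "d_star_cond lam \<mu>1 \<mu>2 d \<longleftrightarrow>
     real d * lam * (1 / \<mu>2 - 1 / \<mu>1) > 1 \<and>
     (1 - 1 / real d) * (\<mu>1 / lam)
       > (real d * lam * (1 / \<mu>2 - 1 / \<mu>1)) powr (1 / (real d - 1))"

definition d_star :: "real \<Rightarrow> real \<Rightarrow> real \<Rightarrow> nat" where
  "d_star lam \<mu>1 \<mu>2 = (LEAST d. d \<ge> 2 \<and> d_star_cond lam \<mu>1 \<mu>2 d)"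

end

theory Submission imports Defs "HOL-Real_Asymp.Real_Asymp" begin

text \<open>If \<open>q\<^sub>0\<^sub>0 = 0\<close>, summing the equations from level \<open>i\<close> to infinity telescopes them to the
  recursion \<open>\<mu>1 * Q i 1 = L * (Q (i - 1) 1) ^ d\<close> with \<open>L\<close> the value of \<open>lam_tilde\<close>, and the balance
  at level 0 determines \<open>L\<close>, so there is a single solution. If \<open>q\<^sub>0\<^sub>0 > 0\<close>, a fixed point lives on
  the three positions \<open>(0,0)\<close>, \<open>(0,1)\<close>, \<open>(1,0)\<close>, and \<open>x = 1 - q\<^sub>0\<^sub>0\<close> is a zero in \<open>[0,1]\<close> of the
  convex function \<open>lam * (1/\<mu>2 - 1/\<mu>1) * x ^ d - x + lam/\<mu>1\<close>. This function is positive at both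
  end points, so it has exactly two zeros as soon as it is negative somewhere in between. The
  condition defining \<open>d_star\<close> says that its minimum is negative and attained in \<open>(0,1)\<close>; since the
  function decreases in \<open>d\<close>, it stays negative there for every larger \<open>d\<close>.\<close>

section \<open>Zeros of convex functions\<close>

text \<open>On the segment, \<open>f\<close> lies below its chord, and a chord from a nonpositive
  value at \<open>x\<close> to a negative value at \<open>y\<close> is negative everywhere except
  possibly at \<open>x\<close>.\<close>

lemma convex_on_neg_between:
  fixes f :: "real \<Rightarrow> real"
  assumes "convex_on S f" "x \<in> S" "y \<in> S" "f x \<le> 0" "f y < 0"
    and z: "z \<in> closed_segment x y" "z \<noteq> x"
  shows "f z < 0"
proof -
  obtain u where u: "0 \<le> u" "u \<le> 1" "z = (1 - u) *\<^sub>R x + u *\<^sub>R y"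
    using z by (auto simp: closed_segment_def)
  with z have "u > 0" by (cases "u = 0") auto
  have "f z \<le> (1 - u) * f x + u * f y"
    using convex_onD[OF assms(1) u(1,2) assms(2,3)] u(3) by simp
  moreover have "(1 - u) * f x \<le> 0"
    using u(2) assms(4) by (simp add: mult_nonneg_nonpos)
  moreover have "u * f y < 0"
    using \<open>u > 0\<close> assms(5) by (simp add: mult_pos_neg)
  ultimately show ?thesis by linarith
qed

lemma convex_card_zeros_eq_2:
  fixes f :: "real \<Rightarrow> real"
  assumes conv: "convex_on {a..b} f" and cont: "continuous_on {a..b} f"
    and "f a > 0" "f b > 0" and y: "y \<in> {a..b}" "f y < 0"
  shows "card {x \<in> {a..b}. f x = 0} = 2"
proof -
  obtain x1 where x1: "a \<le> x1" "x1 \<le> y" "f x1 = 0"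
    using IVT2'[of f y 0 a] assms(3) y continuous_on_subset[OF cont, of "{a..y}"] by auto
  obtain x2 where x2: "y \<le> x2" "x2 \<le> b" "f x2 = 0"
    using IVT'[of f y 0 b] assms(4) y continuous_on_subset[OF cont, of "{y..b}"] by auto
  have "x1 \<noteq> y" "x2 \<noteq> y" using x1 x2 y by auto
  have no_zero: False if "x \<in> {a..b}" "f x = 0" "z \<in> {a..b}" "f z = 0"
      "z \<in> closed_segment x y" "z \<noteq> x" for x z
    using convex_on_neg_between[OF conv that(1) y(1) _ y(2) that(5,6)] that by simp
  have "{x \<in> {a..b}. f x = 0} \<subseteq> {x1, x2}"
  proof
    fix x assume x: "x \<in> {x \<in> {a..b}. f x = 0}"
    show "x \<in> {x1, x2}"
    proof (cases "x \<le> y")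
      case True
      \<comment> \<open>Of two zeros on the same side of \<open>y\<close>, the one nearer to
        \<open>y\<close> lies between the other and \<open>y\<close>. By \<open>no_zero\<close> the
        two must coincide.\<close>
      then have "x1 \<in> closed_segment x y \<or> x \<in> closed_segment x1 y"
        using x1 by (auto simp: closed_segment_eq_real_ivl)
      then show ?thesis using no_zero[of x x1] no_zero[of x1 x] x x1 y by auto
    next
      case False
      then have "x2 \<in> closed_segment x y \<or> x \<in> closed_segment x2 y"
        using x2 by (auto simp: closed_segment_eq_real_ivl)
      then show ?thesis using no_zero[of x x2] no_zero[of x2 x] x x2 y by auto
    qed
  qed
  then have "{x \<in> {a..b}. f x = 0} = {x1, x2}"
    using x1 x2 y by auto
  moreover have "x1 \<noteq> x2" using x1 x2 \<open>x1 \<noteq> y\<close> by auto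
  ultimately show ?thesis by simp
qed

section \<open>States and tail sums\<close>

lemma UNIV_2_eq: "(UNIV :: 2 set) = {0, 1}"
  using exhaust_2 by force

lemma all_2_iff: "(\<forall>j::2. P j) \<longleftrightarrow> P 0 \<and> P 1"
  using UNIV_2_eq by (metis UNIV_I insertE singletonD)

lemma neq_0_2_iff: "(j::2) \<noteq> 0 \<longleftrightarrow> j = 1"
  using UNIV_2_eq by (metis UNIV_I insertE singletonD zero_neq_one)

lemma has_sum_column:
  fixes q :: "nat \<Rightarrow> 'b \<Rightarrow> real"
  shows "((\<lambda>(i, j). q i j) has_sum s) (range (\<lambda>i. (i, j))) \<longleftrightarrow> ((\<lambda>i. q i j) has_sum s) UNIV"
proof -
  have "inj (\<lambda>i::nat. (i, j))" by (simp add: inj_on_def)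
  from has_sum_reindex[OF this, of "\<lambda>(i, j). q i j" s] show ?thesis
    by (simp add: o_def)
qed

text \<open>The index set is the disjoint union of its two columns, so the double sum splits into
  the two tails at level 0. Summability has to be stated separately, because the infinite sum in
  \<open>tail\<close> defaults to 0 on families that are not summable.\<close>

lemma is_state_iff:
  "is_state q \<longleftrightarrow> (\<forall>i j. q i j \<ge> 0) \<and> (\<forall>j. (\<lambda>i. q i j) summable_on UNIV)
     \<and> tail q 0 0 + tail q 0 1 = 1"
proof -
  let ?g = "\<lambda>(i, j). q i j"
  let ?C = "\<lambda>j::2. range (\<lambda>i::nat. (i, j))"
  have C: "UNIV = ?C 0 \<union> ?C 1" "?C 0 \<inter> ?C 1 = {}"
    using UNIV_2_eq by auto
  have glue: "(?g has_sum (tail q 0 0 + tail q 0 1)) UNIV"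
    if "\<And>j. (\<lambda>i. q i j) summable_on UNIV"
  proof -
    have "((\<lambda>i. q i j) has_sum tail q 0 j) UNIV" for j
      using that by (simp add: tail_def)
    then have "(?g has_sum tail q 0 j) (?C j)" for j
      by (simp only: has_sum_column)
    from has_sum_Un_disjoint[OF this this C(2)] show ?thesis
      by (simp only: C(1)[symmetric])
  qed
  have "((\<lambda>(i, j). q i j) has_sum 1) UNIV \<longleftrightarrow>
      (\<forall>j. (\<lambda>i. q i j) summable_on UNIV) \<and> tail q 0 0 + tail q 0 1 = 1" (is "?L \<longleftrightarrow> ?R")
  proof
    assume ?L
    then have sm: "?g summable_on UNIV" by (auto simp: summable_on_def)
    have "?g summable_on ?C j" for j
      by (rule summable_on_subset_banach[OF sm]) auto
    then have col: "(\<lambda>i. q i j) summable_on UNIV" for j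
      using has_sum_column[where q = q and j = j] by (auto simp: summable_on_def)
    from glue[OF this] \<open>?L\<close> have "tail q 0 0 + tail q 0 1 = 1"
      using has_sum_unique by blast
    with col show ?R by blast
  next
    assume R: ?R
    with glue show ?L by simp
  qed
  then show ?thesis by (auto simp: is_state_def)
qed

lemma tail_step:
  assumes "(\<lambda>i. q i j) summable_on UNIV"
  shows "tail q i j = q i j + tail q (Suc i) j"
proof -
  have "{i..} = insert i {Suc i..}" by auto
  moreover have "(\<lambda>i. q i j) summable_on {Suc i..}"
    using assms summable_on_subset_banach by blast
  ultimately show ?thesis
    by (simp add: tail_def infsum_insert)
qed

lemma tail_eq_0: "(\<And>k. k \<ge> i \<Longrightarrow> q k j = 0) \<Longrightarrow> tail q i j = 0"
  unfolding tail_def by (rule infsum_0) auto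

lemma tail_tendsto_0:
  assumes "(\<lambda>i. q i j) summable_on UNIV"
  shows "(\<lambda>i. tail q i j) \<longlonglongrightarrow> 0"
proof -
  have eq: "tail q i j = tail q 0 j - (\<Sum>k<i. q k j)" for i
  proof (induction i)
    case (Suc i)
    then show ?case using tail_step[where q = q and j = j and i = i, OF assms] by simp
  qed simp
  have "(\<lambda>i. \<Sum>k<i. q k j) \<longlonglongrightarrow> tail q 0 j"
    using assms has_sum_imp_sums[of "\<lambda>i. q i j"] by (simp add: tail_def sums_def)
  then have "(\<lambda>i. tail q 0 j - (\<Sum>k<i. q k j)) \<longlonglongrightarrow> tail q 0 j - tail q 0 j"
    by (intro tendsto_intros)
  then show ?thesis
    by (subst eq) simp
qed

text \<open>Telescoping yields a sum in the ordered sense. Since \<open>r\<close> decreases, the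
  terms are nonnegative, and this makes the sum unconditional, as \<open>tail\<close>
  requires.\<close>

lemma has_sum_telescope:
  fixes r :: "nat \<Rightarrow> real"
  assumes "decseq r" "r \<longlonglongrightarrow> 0"
  shows "((\<lambda>k. r k - r (Suc k)) has_sum r i) {i..}"
proof -
  have "((\<lambda>k. r (k + i) - r (Suc k + i)) has_sum r i) UNIV"
  proof (rule sums_nonneg_imp_has_sum)
    show "(\<lambda>k. r (k + i) - r (Suc k + i)) sums r i"
      using telescope_sums'[OF LIMSEQ_ignore_initial_segment[OF assms(2), of i]] by simp
    show "0 \<le> r (k + i) - r (Suc k + i)" for k
      using decseqD[OF assms(1), of "k + i" "Suc k + i"] by simp
  qed
  moreover have "inj (\<lambda>k. k + i)" "range (\<lambda>k. k + i) = {i..}"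
    by (auto simp: image_iff le_iff_add add.commute)
  ultimately show ?thesis
    using has_sum_reindex[of "\<lambda>k. k + i" UNIV "\<lambda>k. r k - r (Suc k)" "r i"] by (simp add: o_def)
qed

section \<open>The fixed points without idle servers\<close>

text \<open>The exponent is the geometric sum 1 + d + ... + d^(i-1), so this is the solution of r
  (i+1) = \<rho> * (r i)^d with r 0 = 1.\<close>

definition qs_tail :: "real \<Rightarrow> nat \<Rightarrow> nat \<Rightarrow> real" where
  "qs_tail \<rho> d i = \<rho> powr ((real d ^ i - 1) / (real d - 1))"

definition qs_state :: "real \<Rightarrow> nat \<Rightarrow> nat \<Rightarrow> 2 \<Rightarrow> real" where
  "qs_state \<rho> d i j = (if j = 0 then 0 else qs_tail \<rho> d i - qs_tail \<rho> d (Suc i))"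

lemma qs_tail_0: "\<rho> > 0 \<Longrightarrow> qs_tail \<rho> d 0 = 1"
  by (simp add: qs_tail_def)

lemma qs_tail_Suc:
  assumes "\<rho> > 0" "d \<ge> 2"
  shows "qs_tail \<rho> d (Suc i) = \<rho> * qs_tail \<rho> d i ^ d"
proof -
  have "(real d ^ Suc i - 1) / (real d - 1) = 1 + (real d ^ i - 1) / (real d - 1) * real d"
    using assms by (simp add: field_simps)
  then show ?thesis
    using assms by (simp add: qs_tail_def powr_add powr_power mult.commute)
qed

lemma qs_tail_bounds:
  assumes "\<rho> > 0" "\<rho> < 1" "d \<ge> 2"
  shows "0 < qs_tail \<rho> d i" "qs_tail \<rho> d i \<le> 1"
    "qs_tail \<rho> d (Suc i) \<le> \<rho> * qs_tail \<rho> d i"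
proof -
  show pos: "0 < qs_tail \<rho> d i" using assms by (simp add: qs_tail_def)
  show le1: "qs_tail \<rho> d i \<le> 1"
    using assms by (auto simp: qs_tail_def intro!: powr_le1 divide_nonneg_nonneg)
  have "qs_tail \<rho> d i ^ d \<le> qs_tail \<rho> d i ^ 1"
    using pos le1 assms by (intro power_decreasing) auto
  then show "qs_tail \<rho> d (Suc i) \<le> \<rho> * qs_tail \<rho> d i"
    using assms by (simp add: qs_tail_Suc)
qed

lemma qs_tail_le_power:
  assumes "\<rho> > 0" "\<rho> < 1" "d \<ge> 2"
  shows "qs_tail \<rho> d i \<le> \<rho> ^ i"
proof (induction i)
  case (Suc i)
  have "qs_tail \<rho> d (Suc i) \<le> \<rho> * qs_tail \<rho> d i" by (rule qs_tail_bounds[OF assms])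
  also have "\<dots> \<le> \<rho> * \<rho> ^ i" using Suc assms by simp
  finally show ?case by simp
qed (use assms qs_tail_0 in simp)

lemma qs_tail_decseq:
  assumes "\<rho> > 0" "\<rho> < 1" "d \<ge> 2"
  shows "decseq (qs_tail \<rho> d)"
proof (rule decseq_SucI)
  fix i
  show "qs_tail \<rho> d (Suc i) \<le> qs_tail \<rho> d i"
    using qs_tail_bounds[OF assms, of i] assms
    by (intro order_trans[OF qs_tail_bounds(3)[OF assms] mult_left_le_one_le]) auto
qed

lemma qs_tail_tendsto_0:
  assumes "\<rho> > 0" "\<rho> < 1" "d \<ge> 2"
  shows "qs_tail \<rho> d \<longlonglongrightarrow> 0"
proof (rule tendsto_sandwich[OF _ _ tendsto_const LIMSEQ_power_zero[of \<rho>]])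
  show "\<forall>\<^sub>F n in sequentially. 0 \<le> qs_tail \<rho> d n"
    using qs_tail_bounds(1)[OF assms] by (simp add: less_imp_le)
  show "\<forall>\<^sub>F n in sequentially. qs_tail \<rho> d n \<le> \<rho> ^ n"
    using qs_tail_le_power[OF assms] by simp
qed (use assms in simp)

lemma tail_qs_state:
  assumes "\<rho> > 0" "\<rho> < 1" "d \<ge> 2"
  shows "tail (qs_state \<rho> d) i 0 = 0" "tail (qs_state \<rho> d) i 1 = qs_tail \<rho> d i"
proof -
  show "tail (qs_state \<rho> d) i 0 = 0"
    by (rule tail_eq_0) (simp add: qs_state_def)
  show "tail (qs_state \<rho> d) i 1 = qs_tail \<rho> d i"
    using has_sum_telescope[OF qs_tail_decseq[OF assms] qs_tail_tendsto_0[OF assms], of i]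
    by (simp add: tail_def qs_state_def infsumI)
qed

lemma is_state_qs_state:
  assumes "\<rho> > 0" "\<rho> < 1" "d \<ge> 2"
  shows "is_state (qs_state \<rho> d)"
proof -
  have "(\<lambda>i. qs_tail \<rho> d i - qs_tail \<rho> d (Suc i)) summable_on {0..}"
    using has_sum_telescope[OF qs_tail_decseq[OF assms] qs_tail_tendsto_0[OF assms], of 0]
    unfolding summable_on_def by blast
  then have "(\<lambda>i. qs_state \<rho> d i j) summable_on UNIV" for j
    by (cases "j = 0") (simp_all add: qs_state_def)
  moreover have "qs_state \<rho> d i j \<ge> 0" for i j
    using qs_tail_decseq[OF assms] by (simp add: qs_state_def decseq_Suc_iff)
  ultimately show ?thesis
    using assms by (simp add: is_state_iff tail_qs_state qs_tail_0)
qed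

lemma FL_fixed_point_qs_state:
  assumes "\<mu>1 > lam" "lam > \<mu>2" "\<mu>2 > 0" "d \<ge> 2" and \<rho>: "\<rho> = (lam - \<mu>2) / (\<mu>1 - \<mu>2)"
  shows "FL_fixed_point lam \<mu>1 \<mu>2 d (qs_state \<rho> d)"
proof -
  have \<rho>01: "\<rho> > 0" "\<rho> < 1" using assms by auto
  \<comment> \<open>This balance is what singles out \<rho>: the left side is the expression inside
    \<open>lam_tilde\<close> at this state, so \<open>lam_tilde\<close> equals
    \<open>\<mu>1 * \<rho>\<close>, which is positive and hence unaffected by the
    truncation.\<close>
  have \<rho>_eq: "lam - \<mu>2 * (1 - \<rho>) = \<mu>1 * \<rho>"
    using assms by (simp add: \<rho> field_simps)
  have r0: "qs_tail \<rho> d 0 = 1" and r1: "qs_tail \<rho> d (Suc 0) = \<rho>"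
    using qs_tail_0[OF \<rho>01(1), of d] qs_tail_Suc[OF \<rho>01(1) assms(4), of 0] by auto
  have lt: "lam_tilde lam \<mu>1 \<mu>2 (qs_state \<rho> d) = \<mu>1 * \<rho>"
    using \<rho>01 assms(1-4) by (simp add: lam_tilde_def qs_state_def r0 r1 \<rho>_eq)
  have rec: "qs_tail \<rho> d (Suc i) = \<rho> * qs_tail \<rho> d i ^ d" for i
    using qs_tail_Suc[OF \<rho>01(1) assms(4)] .
  have e0: "\<mu>2 * (1 - \<rho>) = lam - \<mu>1 * \<rho>" and e1: "\<mu>2 * (\<rho> - 1) = \<mu>1 * \<rho> - lam"
    using \<rho>_eq by (simp_all add: algebra_simps)
  have q00: "qs_state \<rho> d 0 0 = 0" and q10: "qs_state \<rho> d 1 0 = 0"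
    by (simp_all add: qs_state_def)
  have "FL_rhs lam \<mu>1 \<mu>2 d (qs_state \<rho> d) i j = 0" for i j
  proof -
    consider "j = 0" | "j = 1" using neq_0_2_iff by blast
    then show ?thesis
    proof cases
      case 1
      then show ?thesis
        by (simp add: FL_rhs_def Let_def lt tail_qs_state[OF \<rho>01 assms(4)] r0 r1 q00 q10 e0)
    next
      case 2
      show ?thesis
      proof (cases i)
        case 0
        with 2 show ?thesis
          by (simp add: FL_rhs_def Let_def lt tail_qs_state[OF \<rho>01 assms(4)] r0 r1 q00 e1)
      next
        case (Suc n)
        \<comment> \<open>The balance at level \<open>i\<close> is \<open>\<mu>1\<close> times the
          difference of the recursion at two consecutive levels.\<close>
        have "\<mu>1 * (qs_tail \<rho> d (Suc i) - qs_tail \<rho> d i)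
            + \<mu>1 * \<rho> * (qs_tail \<rho> d n ^ d - qs_tail \<rho> d i ^ d) = 0"
          using rec[of i] rec[of n] Suc by (simp add: algebra_simps)
        with 2 Suc show ?thesis
          by (auto simp: FL_rhs_def Let_def lt tail_qs_state[OF \<rho>01 assms(4)] q00 numeral_2_eq_2)
      qed
    qed
  qed
  then show ?thesis
    using is_state_qs_state[OF \<rho>01 assms(4)] by (simp add: FL_fixed_point_def)
qed

lemma FL_fixed_point_no_idle_unique:
  assumes "\<mu>1 > lam" "lam > \<mu>2" "\<mu>2 > 0" "d \<ge> 2" and \<rho>: "\<rho> = (lam - \<mu>2) / (\<mu>1 - \<mu>2)"
    and fp: "FL_fixed_point lam \<mu>1 \<mu>2 d q" and q00: "q 0 0 = 0"
  shows "q = qs_state \<rho> d"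
proof -
  have \<rho>01: "\<rho> > 0" "\<rho> < 1" using assms by auto
  define lt where "lt = lam_tilde lam \<mu>1 \<mu>2 q"
  have st: "is_state q" and rhs: "FL_rhs lam \<mu>1 \<mu>2 d q i j = 0" for i j
    using fp by (auto simp: FL_fixed_point_def)
  have sm: "(\<lambda>i. q i j) summable_on UNIV"
    and tot: "tail q 0 0 + tail q 0 1 = 1" for j
    using st by (auto simp: is_state_iff)
  note step = tail_step[where q = q, OF sm]
  have e00: "\<mu>2 * (tail q 0 1 - tail q 1 1) = lam - lt"
    using rhs[of 0 0] q00 by (simp add: FL_rhs_def Let_def lt_def)
  \<comment> \<open>Without idle servers the equation at (1,0) has no inflow, leaving
    \<open>- \<mu>1 * q 1 0 = 0\<close>.\<close>
  have "q 1 0 = 0"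
    using rhs[of 1 0] q00 step[of 1 0] assms(1-3) by (simp add: FL_rhs_def Let_def numeral_2_eq_2)
  have q0: "q i 0 = 0" for i
  proof (induction i rule: less_induct)
    case (less i)
    show ?case
    proof (cases "i \<le> 1")
      case True
      then show ?thesis using q00 \<open>q 1 0 = 0\<close> by (cases i) auto
    next
      case False
      \<comment> \<open>Since \<open>q (i - 1) 0\<close> vanishes, the two powers in the inflow to
        (i,0) agree and cancel. Only the outflow \<open>\<mu>1 * q i 0\<close> remains.\<close>
      then have "tail q (i - 1) 0 = tail q i 0"
        using step[of "i - 1" 0] less[of "i - 1"] by simp
      then show ?thesis
        using rhs[of i 0] False step[of i 0] assms(1-3) by (simp add: FL_rhs_def Let_def)
    qed
  qed
  have t0: "tail q i 0 = 0" for i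
    using q0 by (intro tail_eq_0) auto
  have Q0: "tail q 0 1 = 1" using tot t0 by simp
  \<comment> \<open>The value at \<open>i = 0\<close> of a quantity that the equations keep constant
    in \<open>i\<close>. The tails tend to 0, so this constant is 0, which gives the recursion
    \<open>rec\<close>.\<close>
  define c where "c = \<mu>1 * tail q (Suc 0) 1 - lt * tail q 0 1 ^ d"
  have "\<mu>1 * (tail q (Suc i) 1 - tail q (Suc (Suc i)) 1)
      = lt * (tail q i 1 ^ d - tail q (Suc i) 1 ^ d)" for i
    using rhs[of "Suc i" 1] q00 t0
    by (cases i) (auto simp: FL_rhs_def Let_def lt_def algebra_simps numeral_2_eq_2)
  then have "\<mu>1 * tail q (Suc (Suc i)) 1 - lt * tail q (Suc i) 1 ^ d
      = \<mu>1 * tail q (Suc i) 1 - lt * tail q i 1 ^ d" for i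
    by (simp add: right_diff_distrib diff_eq_eq eq_diff_eq algebra_simps)
  then have const: "\<mu>1 * tail q (Suc i) 1 - lt * tail q i 1 ^ d = c" for i
    by (induction i) (auto simp: c_def)
  have "(\<lambda>i. \<mu>1 * tail q (Suc i) 1 - lt * tail q i 1 ^ d) \<longlonglongrightarrow> \<mu>1 * 0 - lt * 0 ^ d"
    by (intro tendsto_intros tail_tendsto_0[where q = q, OF sm] LIMSEQ_Suc)
  then have "c = 0"
    using assms(4) LIMSEQ_unique[OF tendsto_const, of c] unfolding const by (auto simp: zero_power)
  with const have rec: "\<mu>1 * tail q (Suc i) 1 = lt * tail q i 1 ^ d" for i
    by simp
  \<comment> \<open>Together with \<open>e00\<close> this is a linear system for \<open>lt\<close>
    and \<open>tail q 1 1\<close>, and it is uniquely solvable because \<mu>1 \<noteq>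
    \<mu>2.\<close>
  have "lt = \<mu>1 * tail q 1 1" using rec[of 0] Q0 by simp
  with e00 Q0 have "(\<mu>1 - \<mu>2) * tail q 1 1 = lam - \<mu>2"
    by (simp add: algebra_simps)
  then have "tail q 1 1 = \<rho>"
    using assms(1,2) by (simp add: \<rho> eq_divide_eq mult.commute)
  with \<open>lt = \<mu>1 * tail q 1 1\<close> have "lt = \<mu>1 * \<rho>" by simp
  then have "tail q (Suc i) 1 = \<rho> * tail q i 1 ^ d" for i
    using rec[of i] assms(1-3) by simp
  then have t1: "tail q i 1 = qs_tail \<rho> d i" for i
    by (induction i) (use Q0 qs_tail_0[OF \<rho>01(1)] qs_tail_Suc[OF \<rho>01(1) assms(4)] in auto)
  show ?thesis
  proof (intro ext)
    fix i j
    show "q i j = qs_state \<rho> d i j"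
      using q0 t1 step[of i 1] neq_0_2_iff[of j] by (cases "j = 0") (auto simp: qs_state_def)
  qed
qed

section \<open>The fixed points with idle servers\<close>

text \<open>With \<open>x\<close> the fraction of busy servers, the entries at (0,1) and (1,0) are
  those at which inflow and outflow balance.\<close>

definition idle_state :: "real \<Rightarrow> real \<Rightarrow> real \<Rightarrow> nat \<Rightarrow> real \<Rightarrow> nat \<Rightarrow> 2 \<Rightarrow> real" where
  "idle_state lam \<mu>1 \<mu>2 d x i j =
    (if i = 0 \<and> j = 0 then 1 - x else if i = 0 then lam * x ^ d / \<mu>2
     else if i = 1 \<and> j = 0 then lam * (1 - x ^ d) / \<mu>1 else 0)"

text \<open>This is the total mass of \<open>idle_state\<close> minus 1.\<close>

definition idle_fun :: "real \<Rightarrow> real \<Rightarrow> real \<Rightarrow> nat \<Rightarrow> real \<Rightarrow> real" where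
  "idle_fun lam \<mu>1 \<mu>2 d x = lam * (1 / \<mu>2 - 1 / \<mu>1) * x ^ d - x + lam / \<mu>1"

lemma state_sum_three:
  assumes "\<And>i j. i \<ge> 2 \<Longrightarrow> q i j = 0" "q 1 1 = 0"
  shows "(\<lambda>i. q i j) summable_on UNIV" "tail q 0 0 + tail q 0 1 = q 0 0 + q 0 1 + q 1 0"
proof -
  show sm: "(\<lambda>i. q i j) summable_on UNIV" for j
    using summable_on_cong_neutral[of UNIV "{..<2}" "\<lambda>i. q i j" "\<lambda>i. q i j"] assms(1) by auto
  have "tail q (Suc (Suc 0)) j = 0" for j
    by (rule tail_eq_0) (use assms in auto)
  then show "tail q 0 0 + tail q 0 1 = q 0 0 + q 0 1 + q 1 0"
    using tail_step[where q = q and i = 0, OF sm] tail_step[where q = q and i = "Suc 0", OF sm] assms(2) by simp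
qed

text \<open>When \<open>q 0 0 > 0\<close>, all terms with \<open>lam_tilde\<close> disappear, and
  differences of consecutive tails are single entries. Every entry other than \<open>q 0 0\<close>
  is then determined by \<open>q 0 0\<close>. The equations at (0,0) and (0,1) are negatives of each
  other, so \<open>q 0 0\<close> itself is restricted only by the requirement of being a
  state.\<close>

lemma FL_fixed_point_idle_iff:
  assumes "\<mu>1 > lam" "lam > \<mu>2" "\<mu>2 > 0" "q 0 0 > 0"
  shows "FL_fixed_point lam \<mu>1 \<mu>2 d q \<longleftrightarrow> is_state q \<and> q = idle_state lam \<mu>1 \<mu>2 d (1 - q 0 0)"
proof (cases "is_state q")
  case True
  then have sm: "(\<lambda>i. q i j) summable_on UNIV" for j
    by (simp add: is_state_iff)
  have diff: "tail q (Suc i) j = tail q i j - q i j" for i j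
    using tail_step[where q = q and i = i and j = j, OF sm] by simp
  have rhs: "FL_rhs lam \<mu>1 \<mu>2 d q i j =
      (if i = 0 then (if j = 0 then 1 else - 1) * (\<mu>2 * q 0 1 - lam * (1 - q 0 0) ^ d)
       else if i = 1 \<and> j = 0 then lam * (1 - (1 - q 0 0) ^ d) - \<mu>1 * q 1 0
       else - \<mu>1 * q i j)" for i j
    using assms(4) neq_0_2_iff[of j]
    by (auto simp: FL_rhs_def Let_def diff numeral_2_eq_2 algebra_simps)
  have "(\<forall>i j. FL_rhs lam \<mu>1 \<mu>2 d q i j = 0) \<longleftrightarrow>
      (\<forall>i j. q i j = idle_state lam \<mu>1 \<mu>2 d (1 - q 0 0) i j)"
    unfolding all_2_iff rhs idle_state_def using assms
    by (intro iff_allI) (auto simp: field_simps)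
  then show ?thesis
    using True by (auto simp: FL_fixed_point_def fun_eq_iff)
qed (simp add: FL_fixed_point_def)

lemma is_state_idle_state_iff:
  assumes "\<mu>1 > lam" "lam > \<mu>2" "\<mu>2 > 0" "x \<in> {0..1}"
  shows "is_state (idle_state lam \<mu>1 \<mu>2 d x) \<longleftrightarrow> idle_fun lam \<mu>1 \<mu>2 d x = 0"
proof -
  have "x ^ d \<le> 1" using assms by (simp add: power_le_one)
  then have "idle_state lam \<mu>1 \<mu>2 d x i j \<ge> 0" for i j
    using assms by (simp add: idle_state_def)
  moreover have "idle_state lam \<mu>1 \<mu>2 d x i j = 0" if "i \<ge> 2" for i j
    using that by (simp add: idle_state_def)
  moreover have "idle_state lam \<mu>1 \<mu>2 d x 1 1 = 0" by (simp add: idle_state_def)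
  ultimately have "is_state (idle_state lam \<mu>1 \<mu>2 d x) \<longleftrightarrow>
      1 - x + lam * x ^ d / \<mu>2 + lam * (1 - x ^ d) / \<mu>1 = 1"
    by (simp add: is_state_iff state_sum_three) (simp add: idle_state_def)
  also have "\<dots> \<longleftrightarrow> idle_fun lam \<mu>1 \<mu>2 d x = 0"
    by (simp add: idle_fun_def algebra_simps diff_divide_distrib)
  finally show ?thesis .
qed

lemma idle_fun_1_pos: "\<mu>2 > 0 \<Longrightarrow> lam > \<mu>2 \<Longrightarrow> idle_fun lam \<mu>1 \<mu>2 d 1 > 0"
  by (simp add: idle_fun_def algebra_simps)

lemma idle_fixed_points_eq_image:
  assumes "\<mu>1 > lam" "lam > \<mu>2" "\<mu>2 > 0"
  shows "{q. FL_fixed_point lam \<mu>1 \<mu>2 d q \<and> q 0 0 > 0} =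
    idle_state lam \<mu>1 \<mu>2 d ` {x \<in> {0..1}. idle_fun lam \<mu>1 \<mu>2 d x = 0}" (is "?L = ?R")
proof (intro equalityI subsetI)
  fix q assume q: "q \<in> ?L"
  then have st: "is_state q" and eq: "q = idle_state lam \<mu>1 \<mu>2 d (1 - q 0 0)"
    using FL_fixed_point_idle_iff[OF assms, of q d] by auto
  have nn: "q i j \<ge> 0" for i j using st by (simp add: is_state_iff)
  have "q i j = 0" if "i \<ge> 2" for i j
    by (subst eq) (use that in \<open>simp add: idle_state_def\<close>)
  moreover have "q 1 1 = 0" by (subst eq) (simp add: idle_state_def)
  ultimately have "q 0 0 + q 0 1 + q 1 0 = 1"
    using st state_sum_three(2)[of q] by (simp add: is_state_iff)
  then have x: "1 - q 0 0 \<in> {0..1}" using nn[of 0 0] nn[of 0 1] nn[of 1 0] by auto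
  then have "idle_fun lam \<mu>1 \<mu>2 d (1 - q 0 0) = 0"
    using is_state_idle_state_iff[OF assms x, of d] st eq by simp
  with x eq show "q \<in> ?R" by blast
next
  fix q assume "q \<in> ?R"
  then obtain x where x: "x \<in> {0..1}" "idle_fun lam \<mu>1 \<mu>2 d x = 0"
      and q: "q = idle_state lam \<mu>1 \<mu>2 d x" by auto
  \<comment> \<open>The value x = 1 would mean \<open>q 0 0 = 0\<close>. It is no zero, since
    \<open>idle_fun\<close> at 1 equals \<open>lam / \<mu>2 - 1\<close>.\<close>
  have "x \<noteq> 1" using x idle_fun_1_pos[of \<mu>2 lam \<mu>1 d] assms by auto
  moreover have "q 0 0 = 1 - x" by (simp add: q idle_state_def)
  ultimately show "q \<in> ?L"
    using x q FL_fixed_point_idle_iff[OF assms, of q d] is_state_idle_state_iff[OF assms x(1), of d]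
    by auto
qed

text \<open>The entry at (0,0) recovers \<open>x\<close>, so counting zeros of
  \<open>idle_fun\<close> counts fixed points.\<close>

lemma inj_idle_state: "inj (idle_state lam \<mu>1 \<mu>2 d)"
  by (rule injI, drule fun_cong[of _ _ 0], drule fun_cong[of _ _ 0]) (simp add: idle_state_def)

lemma idle_fixed_point_sum_1:
  assumes "\<mu>1 > lam" "lam > \<mu>2" "\<mu>2 > 0" "FL_fixed_point lam \<mu>1 \<mu>2 d q" "q 0 0 > 0"
  shows "q 0 0 + q 0 1 + q 1 0 = 1"
proof -
  have "q \<in> {q. FL_fixed_point lam \<mu>1 \<mu>2 d q \<and> q 0 0 > 0}" using assms by simp
  then show ?thesis
    unfolding idle_fixed_points_eq_image[OF assms(1-3)]
    by (auto simp: idle_fun_def idle_state_def algebra_simps diff_divide_distrib)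
qed

section \<open>The threshold\<close>

lemma idle_fun_neg_of_d_star_cond:
  assumes "\<mu>1 > lam" "lam > \<mu>2" "\<mu>2 > 0" "d \<ge> 2" "d_star_cond lam \<mu>1 \<mu>2 d"
  shows "\<exists>y\<in>{0<..<1}. idle_fun lam \<mu>1 \<mu>2 d y < 0"
proof -
  define a where "a = lam * (1 / \<mu>2 - 1 / \<mu>1)"
  define p where "p = (real d * a) powr (1 / (real d - 1))"
  \<comment> \<open>the minimizer of the function\<close>
  define y where "y = 1 / p"
  have da: "real d * a > 1"
    and c: "(1 - 1 / real d) * (\<mu>1 / lam) > p"
    using assms(5) by (auto simp: d_star_cond_def a_def p_def mult.assoc)
  \<comment> \<open>The first inequality of \<open>d_star_cond\<close> places the minimizer to the
    left of 1.\<close>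
  have p: "p > 1"
    using powr_less_mono2[of "1 / (real d - 1)" 1 "real d * a"] da assms(4) by (simp add: p_def)
  then have y: "0 < y" "y < 1" by (auto simp: y_def)
  have "p ^ (d - 1) = p powr real (d - 1)"
    using p by (subst powr_realpow) auto
  also have "\<dots> = real d * a"
    using da assms(4) by (simp add: p_def powr_powr of_nat_diff)
  finally have "y ^ (d - 1) = 1 / (real d * a)"
    by (simp add: y_def power_one_over)
  \<comment> \<open>The derivative vanishes at \<open>y\<close>, that is,
    \<open>d * a * y ^ (d - 1) = 1\<close>. The minimum is therefore
    \<open>lam / \<mu>1 - (1 - 1 / d) * y\<close>, and the second inequality of
    \<open>d_star_cond\<close> says that it is negative.\<close>
  then have "a * y ^ d = y / real d"
    using da assms(4) power_minus_mult[of d y, symmetric] by auto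
  moreover have "lam / \<mu>1 < (1 - 1 / real d) * y"
    using c p assms(1-3) by (simp add: y_def field_simps)
  ultimately have "idle_fun lam \<mu>1 \<mu>2 d y < 0"
    unfolding idle_fun_def a_def[symmetric] by (simp add: left_diff_distrib)
  with y show ?thesis by auto
qed

text \<open>Powers of a number in [0,1] decrease in the exponent, and the coefficient of the power
  is nonnegative. A point of negativity found for \<open>d_star\<close> thus serves for every larger
  exponent, with no need to know that \<open>d_star_cond\<close> persists.\<close>

lemma idle_fun_antimono_exponent:
  assumes "\<mu>1 > \<mu>2" "\<mu>2 > 0" "lam > 0" "0 \<le> y" "y \<le> 1" "d \<le> d'"
  shows "idle_fun lam \<mu>1 \<mu>2 d' y \<le> idle_fun lam \<mu>1 \<mu>2 d y"
proof -
  have "lam * (1 / \<mu>2 - 1 / \<mu>1) \<ge> 0" using assms by (simp add: field_simps)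
  then show ?thesis
    using power_decreasing[OF assms(6,4,5)] by (simp add: idle_fun_def mult_left_mono)
qed

lemma card_idle_fun_zeros:
  assumes "\<mu>1 > lam" "lam > \<mu>2" "\<mu>2 > 0" "d \<ge> 2" "y \<in> {0..1}" "idle_fun lam \<mu>1 \<mu>2 d y < 0"
  shows "card {x \<in> {0..1}. idle_fun lam \<mu>1 \<mu>2 d x = 0} = 2"
proof (rule convex_card_zeros_eq_2)
  have a: "lam * (1 / \<mu>2 - 1 / \<mu>1) \<ge> 0" using assms by (simp add: field_simps)
  have "convex_on {0..1} (\<lambda>x::real. x ^ d)"
    using convex_on_subset[OF convex_power_odd[of d], of "{0..1}"]
      convex_on_subset[OF convex_power_even[of d], of "{0..1}"] by (cases "even d") auto
  from convex_on_cmul[OF a this]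
  show "convex_on {0..1} (idle_fun lam \<mu>1 \<mu>2 d)"
    unfolding idle_fun_def
    by (intro convex_on_add convex_on_diff) (auto simp: convex_on_const concave_on_ident)
  show "continuous_on {0..1} (idle_fun lam \<mu>1 \<mu>2 d)"
    unfolding idle_fun_def by (intro continuous_intros)
  show "0 < idle_fun lam \<mu>1 \<mu>2 d 0" using assms by (simp add: idle_fun_def zero_power)
  show "0 < idle_fun lam \<mu>1 \<mu>2 d 1" using assms by (simp add: idle_fun_1_pos)
qed (use assms in auto)

text \<open>As d grows, \<open>d * a\<close> is unbounded, while \<open>1 - 1 / d\<close> and
  \<open>(d * a) powr (1 / (d - 1))\<close> both tend to 1. Since \<open>\<mu>1 / lam > 1\<close>,
  both inequalities hold eventually. Hence the \<open>LEAST\<close> in \<open>d_star\<close> is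
  attained.\<close>

lemma ex_d_star_cond:
  assumes "\<mu>1 > lam" "lam > \<mu>2" "\<mu>2 > 0"
  shows "\<exists>d\<ge>2. d_star_cond lam \<mu>1 \<mu>2 d"
proof -
  define a where "a = lam * (1 / \<mu>2 - 1 / \<mu>1)"
  have a: "a > 0" using assms by (simp add: a_def field_simps)
  have "\<forall>\<^sub>F d in sequentially. real d * a > 1"
    using a by real_asymp
  moreover have "\<forall>\<^sub>F d in sequentially.
      (1 - 1 / real d) * c > (real d * a) powr (1 / (real d - 1))" if "c > 1" for c
  proof -
    have "(\<lambda>d::nat. (1 - 1 / real d) * c - (real d * a) powr (1 / (real d - 1))) \<longlonglongrightarrow> c - 1"
      using a by real_asymp
    from order_tendstoD(1)[OF this, of 0] that show ?thesis by simp
  qed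
  from this[of "\<mu>1 / lam"]
  have "\<forall>\<^sub>F d in sequentially.
      (1 - 1 / real d) * (\<mu>1 / lam) > (real d * a) powr (1 / (real d - 1))"
    using assms by simp
  ultimately have "\<forall>\<^sub>F d in sequentially. d \<ge> 2 \<and> d_star_cond lam \<mu>1 \<mu>2 d"
    using eventually_ge_at_top[of 2]
    by eventually_elim (simp add: d_star_cond_def a_def mult.assoc)
  then show ?thesis
    using eventually_happens by fastforce
qed

theorem theorem4p1:
  fixes lam \<mu>1 \<mu>2 :: real and d1 :: nat
  assumes "\<mu>1 > lam" and "lam > \<mu>2" and "\<mu>2 > 0" and "d1 \<ge> 2"
  shows "(\<exists>d\<ge>2. d_star_cond lam \<mu>1 \<mu>2 d) \<and>
    (\<exists>qs. FL_fixed_point lam \<mu>1 \<mu>2 d1 qs \<and>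
      (\<forall>i. tail qs i 0 = 0 \<and>
           tail qs i 1 =
             ((lam - \<mu>2) / (\<mu>1 - \<mu>2)) powr ((real d1 ^ i - 1) / (real d1 - 1))) \<and>
      (d1 \<ge> d_star lam \<mu>1 \<mu>2 \<longrightarrow>
        card {q. FL_fixed_point lam \<mu>1 \<mu>2 d1 q \<and> q \<noteq> qs} = 2 \<and>
        (\<forall>q. FL_fixed_point lam \<mu>1 \<mu>2 d1 q \<and> q \<noteq> qs \<longrightarrow>
          q 0 0 + q 0 1 + q 1 0 = 1 \<and> q 0 0 > 0)))"
proof -
  define \<rho> where "\<rho> = (lam - \<mu>2) / (\<mu>1 - \<mu>2)"
  have \<rho>01: "\<rho> > 0" "\<rho> < 1" using assms by (auto simp: \<rho>_def)
  \<comment> \<open>Every state has \<open>q 0 0 \<ge> 0\<close>, and the only fixed point with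
    \<open>q 0 0 = 0\<close> is \<open>qs_state\<close>. Excluding it is therefore the same as
    requiring \<open>q 0 0 > 0\<close>.\<close>
  have other: "FL_fixed_point lam \<mu>1 \<mu>2 d1 q \<and> q \<noteq> qs_state \<rho> d1 \<longleftrightarrow>
      FL_fixed_point lam \<mu>1 \<mu>2 d1 q \<and> q 0 0 > 0" for q
  proof -
    have "q 0 0 \<ge> 0" if "FL_fixed_point lam \<mu>1 \<mu>2 d1 q"
      using that by (simp add: FL_fixed_point_def is_state_def)
    moreover have "qs_state \<rho> d1 0 0 = 0" by (simp add: qs_state_def)
    ultimately show ?thesis
      using FL_fixed_point_no_idle_unique[OF assms \<rho>_def, of q] by fastforce
  qed
  have card: "card {q. FL_fixed_point lam \<mu>1 \<mu>2 d1 q \<and> q 0 0 > 0} = 2"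
    if "d1 \<ge> d_star lam \<mu>1 \<mu>2"
  proof -
    let ?d = "d_star lam \<mu>1 \<mu>2"
    have "?d \<ge> 2 \<and> d_star_cond lam \<mu>1 \<mu>2 ?d"
      unfolding d_star_def by (rule LeastI_ex) (use ex_d_star_cond[OF assms(1-3)] in blast)
    then obtain y where y: "y \<in> {0<..<1}" "idle_fun lam \<mu>1 \<mu>2 ?d y < 0"
      using idle_fun_neg_of_d_star_cond[OF assms(1-3)] by blast
    then have "idle_fun lam \<mu>1 \<mu>2 d1 y < 0"
      using idle_fun_antimono_exponent[of \<mu>2 \<mu>1 lam y ?d d1] that assms by simp
    then have "card {x \<in> {0..1}. idle_fun lam \<mu>1 \<mu>2 d1 x = 0} = 2"
      using card_idle_fun_zeros[OF assms, of y] y by simp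
    then show ?thesis
      unfolding idle_fixed_points_eq_image[OF assms(1-3)]
      by (simp add: card_image inj_on_subset[OF inj_idle_state])
  qed
  show ?thesis
  proof (intro conjI exI[of _ "qs_state \<rho> d1"] impI allI)
    show "\<exists>d\<ge>2. d_star_cond lam \<mu>1 \<mu>2 d" by (rule ex_d_star_cond[OF assms(1-3)])
    show "FL_fixed_point lam \<mu>1 \<mu>2 d1 (qs_state \<rho> d1)"
      by (rule FL_fixed_point_qs_state[OF assms \<rho>_def])
    show "tail (qs_state \<rho> d1) i 0 = 0" for i
      by (rule tail_qs_state[OF \<rho>01 assms(4)])
    show "tail (qs_state \<rho> d1) i 1 =
        ((lam - \<mu>2) / (\<mu>1 - \<mu>2)) powr ((real d1 ^ i - 1) / (real d1 - 1))" for i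
      using tail_qs_state(2)[OF \<rho>01 assms(4)] by (simp add: qs_tail_def \<rho>_def)
    show "card {q. FL_fixed_point lam \<mu>1 \<mu>2 d1 q \<and> q \<noteq> qs_state \<rho> d1} = 2"
      if "d1 \<ge> d_star lam \<mu>1 \<mu>2"
      using card[OF that] by (simp add: other)
  next
    fix q assume "FL_fixed_point lam \<mu>1 \<mu>2 d1 q \<and> q \<noteq> qs_state \<rho> d1"
    then show "q 0 0 + q 0 1 + q 1 0 = 1" "q 0 0 > 0"
      using other[of q] idle_fixed_point_sum_1[OF assms(1-3)] by auto
  qed
qed

end
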